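(* Let $\alpha>0$ and let $\{h_k\}_{k\in\mathbf{N}}\subset Y$ be a countable set with $\|h_k\|_Y=1$ for all $k$ which is dense in the unit sphere of $Y$, i.e. for every $g\in Y$ with $\|g\|_Y=1$ and every $\epsilon>0$ there is an index $k_0$ such that $\|g-h_{k_0}\|_Y\le\epsilon$. Let $K$ be given by $Ku=\sum_k u_kh_k$. Let $g\in Y$ satisfy $\|g\|_Y^2>\alpha$ and suppose that, for every $k$, $g$ is not a multiple of $h_k$. Then the functional $$\Psi(u)=\|Ku-g\|_Y^2+\alpha\sum_k\operatorname{sgn}(|u_k|)$$ does not have a minimizer.
   Context: $Y$ is a real Hilbert space. The functional $\Psi$ is considered on real sequences $u=(u_k)_{k\in\mathbf{N}}\in\ell^2$; $\operatorname{sgn}$ is the usual sign with $\operatorname{sgn}(0)=0$, so $\sum_k\operatorname{sgn}(|u_k|)$ is the number of non-zero entries of $u$. If $u$ has infinitely many non-zero entries, then $\Psi(u)=+\infty$; for finitely supported $u$ the sum defining $Ku$ is finite. *)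

theory Defs
  imports "HOL-Analysis.Analysis"
begin

definition ell2 :: "(nat \<Rightarrow> real) set" where
  "ell2 = {u. summable (\<lambda>k. (u k)\<^sup>2)}"

(* If u has infinitely many non-zero entries, the series need not converge and then the
   value is meaningless. *)
definition synthesis :: "(nat \<Rightarrow> 'a::real_normed_vector) \<Rightarrow> (nat \<Rightarrow> real) \<Rightarrow> 'a" where
  "synthesis h u = (\<Sum>k. u k *\<^sub>R h k)"

(* The sum of signs is taken in the extended reals, so it is infinite when u has infinitely
   many non-zero entries.  For \<alpha> > 0 the functional is then infinite too, whatever
   the value of synthesis h u; see Psi_infinite_support and Psi_finite_support. *)
definition Psi ::
  "(nat \<Rightarrow> 'a::real_normed_vector) \<Rightarrow> 'a \<Rightarrow> real \<Rightarrow> (nat \<Rightarrow> real) \<Rightarrow> ereal" where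
  "Psi h g \<alpha> u =
     ereal ((norm (synthesis h u - g))\<^sup>2) + ereal \<alpha> * (\<Sum>k. ereal (sgn \<bar>u k\<bar>))"

lemma Psi_finite_support:
  assumes "finite {k. u k \<noteq> 0}"
  shows "Psi h g \<alpha> u =
    ereal ((norm ((\<Sum>k | u k \<noteq> 0. u k *\<^sub>R h k) - g))\<^sup>2 + \<alpha> * real (card {k. u k \<noteq> 0}))"
proof -
  have 1: "synthesis h u = (\<Sum>k | u k \<noteq> 0. u k *\<^sub>R h k)"
    unfolding synthesis_def by (rule suminf_finite[OF assms]) simp
  have "(\<Sum>k. ereal (sgn \<bar>u k\<bar>)) = (\<Sum>k | u k \<noteq> 0. ereal (sgn \<bar>u k\<bar>))"
    by (rule suminf_finite[OF assms]) (simp add: zero_ereal_def)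
  also have "\<dots> = (\<Sum>k | u k \<noteq> 0. ereal 1)"
    by (rule sum.cong) (auto simp: sgn_if)
  finally have 2: "(\<Sum>k. ereal (sgn \<bar>u k\<bar>)) = ereal (real (card {k. u k \<noteq> 0}))"
    by simp
  show ?thesis
    unfolding Psi_def 1 2 by simp
qed

lemma Psi_infinite_support:
  assumes "infinite {k. u k \<noteq> 0}" and "\<alpha> > 0"
  shows "Psi h g \<alpha> u = \<infinity>"
proof -
  have "(\<Sum>k. ereal (sgn \<bar>u k\<bar>)) = \<infinity>"
  proof (rule ereal_top)
    fix B :: real
    obtain n :: nat where n: "B \<le> real n"
      using real_arch_simple by blast
    obtain F where F: "finite F" "card F = n" "F \<subseteq> {k. u k \<noteq> 0}"
      using infinite_arbitrarily_large[OF assms(1)] by blast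
    have "ereal B \<le> ereal (real (card F))"
      using n F by simp
    also have "\<dots> = (\<Sum>k\<in>F. ereal 1)"
      by simp
    also have "\<dots> = (\<Sum>k\<in>F. ereal (sgn \<bar>u k\<bar>))"
      by (rule sum.cong) (use F(3) in \<open>auto simp: sgn_if\<close>)
    also have "\<dots> \<le> (\<Sum>k. ereal (sgn \<bar>u k\<bar>))"
      by (rule sum_le_suminf) (auto simp: F sgn_if intro: summable_ereal_pos)
    finally show "ereal B \<le> (\<Sum>k. ereal (sgn \<bar>u k\<bar>))" .
  qed
  with assms(2) show ?thesis
    unfolding Psi_def by simp
qed

end

theory Submission imports Defs begin

text \<open>
  The infimum of the functional is \<open>\<alpha>\<close>, and it is not attained. One atom
  \<open>h k\<close> close to the direction of \<open>g\<close>, scaled by the norm of \<open>g\<close>, gives values arbitrarily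
  close to \<open>\<alpha>\<close>. Conversely, the zero sequence gives \<open>(norm g)\<^sup>2 > \<alpha>\<close>, one non-zero entry
  leaves a non-zero residual on top of the penalty \<open>\<alpha>\<close>, and two or more entries
  cost at least \<open>2 * \<alpha>\<close>.
\<close>

text \<open>The condition on \<open>c\<close> keeps the support equal to \<open>{k}\<close>, so that
  the penalty is exactly \<open>\<alpha>\<close>.\<close>

lemma Psi_single:
  assumes "c \<noteq> 0"
  shows "Psi h g \<alpha> (\<lambda>j. if j = k then c else 0) = ereal ((norm (c *\<^sub>R h k - g))\<^sup>2 + \<alpha>)"
proof -
  have "{j. (if j = k then c else 0) \<noteq> 0} = {k}"
    using assms by auto
  then show ?thesis
    by (simp add: Psi_finite_support)
qed

lemma single_in_ell2: "(\<lambda>j. if j = k then c else 0) \<in> ell2"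
  unfolding ell2_def by (auto intro!: summable_finite[of "{k}"] split: if_splits)

lemma Psi_greater:
  fixes h :: "nat \<Rightarrow> 'a::real_normed_vector"
  assumes "\<alpha> > 0" and "(norm g)\<^sup>2 > \<alpha>"
    and not_multiple: "\<And>k c. g \<noteq> c *\<^sub>R h k"
  shows "Psi h g \<alpha> u > ereal \<alpha>"
proof (cases "finite {k. u k \<noteq> 0}")
  case False
  then show ?thesis
    by (simp add: Psi_infinite_support \<open>\<alpha> > 0\<close>)
next
  case True
  define S where "S = {k. u k \<noteq> 0}"
  define v where "v = (\<Sum>k\<in>S. u k *\<^sub>R h k)"
  have Psi: "Psi h g \<alpha> u = ereal ((norm (v - g))\<^sup>2 + \<alpha> * real (card S))"
    using Psi_finite_support[OF True, of h g \<alpha>] by (simp add: S_def v_def)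
  consider "card S = 0" | "card S = 1" | "2 \<le> card S"
    by linarith
  then have "(norm (v - g))\<^sup>2 + \<alpha> * real (card S) > \<alpha>"
  proof cases
    case 1
    \<comment> \<open>Infinite sets also have \<open>card\<close> 0; finiteness of the support
      excludes them.\<close>
    then have "S = {}"
      using True by (simp add: S_def)
    then show ?thesis
      using \<open>(norm g)\<^sup>2 > \<alpha>\<close> by (simp add: v_def)
  next
    case 2
    then obtain k where "S = {k}"
      by (auto simp: card_1_singleton_iff)
    then show ?thesis
      using not_multiple[of "u k" k] by (simp add: v_def)
  next
    case 3
    \<comment> \<open>The residual may vanish here; strictness comes from
      \<open>\<alpha> < 2 * \<alpha>\<close>.\<close>
    then have "\<alpha> * 2 \<le> \<alpha> * real (card S)"
      using \<open>\<alpha> > 0\<close> by (intro mult_left_mono) auto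
    moreover have "0 \<le> (norm (v - g))\<^sup>2"
      by simp
    ultimately show ?thesis
      using \<open>\<alpha> > 0\<close> by linarith
  qed
  then show ?thesis
    by (simp add: Psi)
qed

text \<open>The bound \<open>b\<close> is an extended real so that it can be the value of the
  functional at a supposed minimizer.\<close>

lemma Psi_arbitrarily_small:
  fixes h :: "nat \<Rightarrow> 'a::real_normed_vector"
  assumes dense: "\<And>f \<epsilon>. norm f = 1 \<Longrightarrow> \<epsilon> > 0 \<Longrightarrow> \<exists>k. norm (f - h k) \<le> \<epsilon>"
    and "g \<noteq> 0" and "ereal \<alpha> < b"
  shows "\<exists>u\<in>ell2. Psi h g \<alpha> u < b"
proof -
  \<comment> \<open>As \<open>b\<close> may be infinite, a real \<open>r\<close> below it fixes the
    budget \<open>r - \<alpha>\<close> for the squared residual.\<close>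
  obtain r where r: "\<alpha> < r" "ereal r < b"
    using ereal_dense2[OF \<open>ereal \<alpha> < b\<close>] by auto
  \<comment> \<open>Density applies to the normalized \<open>g\<close>; scaling back multiplies the
    error by \<open>norm g\<close>, which the denominator cancels.\<close>
  define \<epsilon> where "\<epsilon> = sqrt (r - \<alpha>) / norm g"
  have "\<epsilon> > 0"
    using r \<open>g \<noteq> 0\<close> by (simp add: \<epsilon>_def)
  moreover have "norm (g /\<^sub>R norm g) = 1"
    using \<open>g \<noteq> 0\<close> by simp
  ultimately obtain k where k: "norm (g /\<^sub>R norm g - h k) \<le> \<epsilon>"
    using dense by blast
  have "norm g *\<^sub>R h k - g = - (norm g *\<^sub>R (g /\<^sub>R norm g - h k))"
    using \<open>g \<noteq> 0\<close> by (simp add: scaleR_diff_right)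
  then have "norm (norm g *\<^sub>R h k - g) = norm g * norm (g /\<^sub>R norm g - h k)"
    by simp
  also have "\<dots> \<le> norm g * \<epsilon>"
    using k by (intro mult_left_mono) auto
  also have "\<dots> = sqrt (r - \<alpha>)"
    using \<open>g \<noteq> 0\<close> by (simp add: \<epsilon>_def)
  finally have "(norm (norm g *\<^sub>R h k - g))\<^sup>2 \<le> r - \<alpha>"
    using r by (metis norm_ge_zero power_mono real_sqrt_pow2 diff_ge_0_iff_ge less_imp_le)
  then have "Psi h g \<alpha> (\<lambda>j. if j = k then norm g else 0) \<le> ereal r"
    using \<open>g \<noteq> 0\<close> by (simp add: Psi_single)
  then show ?thesis
    using r(2) single_in_ell2 by (meson le_less_trans)
qed

theorem proposition5p5:
  fixes h :: "nat \<Rightarrow> 'a::{real_inner, complete_space}"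
    and g :: 'a
    and \<alpha> :: real
  assumes "\<alpha> > 0"
    and "\<And>k. norm (h k) = 1"
    and "\<And>f \<epsilon>. norm f = 1 \<Longrightarrow> \<epsilon> > 0 \<Longrightarrow> \<exists>k. norm (f - h k) \<le> \<epsilon>"
    and "(norm g)\<^sup>2 > \<alpha>"
    and "\<And>k. \<not> (\<exists>c. g = c *\<^sub>R h k)"
  shows "\<not> (\<exists>u. is_arg_min (Psi h g \<alpha>) (\<lambda>u. u \<in> ell2) u)"
proof
  assume "\<exists>u. is_arg_min (Psi h g \<alpha>) (\<lambda>u. u \<in> ell2) u"
  then obtain u where u: "is_arg_min (Psi h g \<alpha>) (\<lambda>u. u \<in> ell2) u" ..
  have "ereal \<alpha> < Psi h g \<alpha> u"
    using assms(1,4,5) by (intro Psi_greater) auto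
  moreover have "g \<noteq> 0"
    using assms(1,4) by auto
  \<comment> \<open>The bound \<open>b\<close> is taken to be
    \<open>Psi h g \<alpha> u\<close>.\<close>
  ultimately obtain v where "v \<in> ell2" "Psi h g \<alpha> v < Psi h g \<alpha> u"
    using Psi_arbitrarily_small[of h g \<alpha>] assms(3) by blast
  with u show False
    by (auto simp: is_arg_min_def)
qed

end
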